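(* (a) There exists a convex body $K$ (indeed a rational polytope in $\mathbb{R}^2$) for which the set of nonzero integer directions $c$ attaining the minimum lattice width $w(K)=w_c(K)$ differs from the set of nonzero integer directions $c$ attaining the minimum arithmetic width $\mathrm{aw}(K)=\mathrm{aw}_c(K)$. (b) For every finite set $A\subset\mathbb{Z}$ there exist $k\geq1$, a rational simplex $\Delta\subset\mathbb{R}^k$ and $c\in\mathbb{Z}^k$ such that $\mathrm{AR}_c(\Delta)=A$.
   Context: For a convex body (compact convex set) $K\subseteq\mathbb{R}^d$ and $c\in\mathbb{Z}^d\setminus\{0\}$: the lattice width in direction $c$ is $w_c(K)=\max_{x,y\in K}c^T(x-y)$ and the lattice width is $w(K)=\min_{c\in\mathbb{Z}^d\setminus\{0\}}w_c(K)$; the arithmetic range is $\mathrm{AR}_c(K)=\{n\in\mathbb{Z}:n=c^Tx\text{ for some }x\in K\cap\mathbb{Z}^d\}$; the arithmetic width in direction $c$ is $\mathrm{aw}_c(K)=|\mathrm{AR}_c(K)|$ (the number of hyperplanes with normal $c$ meeting $K\cap\mathbb{Z}^d$), and $\mathrm{aw}(K)=\min_{c\in\mathbb{Z}^d\setminus\{0\}}\mathrm{aw}_c(K)$. A rational simplex is the convex hull of affinely independent points with rational coordinates. *)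

theory Defs
  imports "HOL-Analysis.Analysis" "HOL-Analysis.Finite_Function_Topology"
begin

(* All the spaces R^d live inside the real normed space of finitely supported sequences, so that
   the dimension can be quantified over.  On each R^d the normed topology is the usual one, and
   convex and affine hulls of subsets of R^d are the usual ones. *)
type_synonym rvec = "nat \<Rightarrow>\<^sub>0 real"

definition Rd :: "nat \<Rightarrow> rvec set" where
  "Rd d = {x. Poly_Mapping.keys x \<subseteq> {..<d}}"

definition Qd :: "nat \<Rightarrow> rvec set" where
  "Qd d = {x \<in> Rd d. \<forall>i<d. Poly_Mapping.lookup x i \<in> \<rat>}"

definition Zd :: "nat \<Rightarrow> rvec set" where
  "Zd d = {x \<in> Rd d. \<forall>i<d. Poly_Mapping.lookup x i \<in> \<int>}"

definition dotp :: "nat \<Rightarrow> rvec \<Rightarrow> rvec \<Rightarrow> real" where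
  "dotp d c x = (\<Sum>i<d. Poly_Mapping.lookup c i * Poly_Mapping.lookup x i)"

(* No interior point is required; nonemptiness is needed for the maximum defining the width. *)
definition convex_body :: "nat \<Rightarrow> rvec set \<Rightarrow> bool" where
  "convex_body d K \<longleftrightarrow> K \<subseteq> Rd d \<and> K \<noteq> {} \<and> compact K \<and> convex K"

definition rational_polytope :: "nat \<Rightarrow> rvec set \<Rightarrow> bool" where
  "rational_polytope d K \<longleftrightarrow>
     (\<exists>V. finite V \<and> V \<noteq> {} \<and> V \<subseteq> Qd d \<and> K = convex hull V)"

definition rational_simplex :: "nat \<Rightarrow> rvec set \<Rightarrow> bool" where
  "rational_simplex d K \<longleftrightarrow>
     (\<exists>V. finite V \<and> V \<noteq> {} \<and> V \<subseteq> Qd d \<and> \<not> affine_dependent V \<and> K = convex hull V)"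

definition directions :: "nat \<Rightarrow> rvec set" where
  "directions d = Zd d - {0}"

(* For a convex body the supremum is attained, by compactness. *)
definition lattice_width_dir :: "nat \<Rightarrow> rvec \<Rightarrow> rvec set \<Rightarrow> real" where
  "lattice_width_dir d c K = Sup {dotp d c (x - y) | x y. x \<in> K \<and> y \<in> K}"

(* The infimum is taken over nonnegative reals.  For a rational polytope the directional widths
   lie in (1/q)Z for some q, so the infimum is a minimum. *)
definition lattice_width :: "nat \<Rightarrow> rvec set \<Rightarrow> real" where
  "lattice_width d K = (INF c\<in>directions d. lattice_width_dir d c K)"

definition arith_range :: "nat \<Rightarrow> rvec \<Rightarrow> rvec set \<Rightarrow> int set" where
  "arith_range d c K = {n. \<exists>x \<in> K \<inter> Zd d. of_int n = dotp d c x}"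

(* The range is finite when K is bounded, so card does not degenerate. *)
definition arith_width_dir :: "nat \<Rightarrow> rvec \<Rightarrow> rvec set \<Rightarrow> nat" where
  "arith_width_dir d c K = card (arith_range d c K)"

(* An infimum of a nonempty set of natural numbers is its least element. *)
definition arith_width :: "nat \<Rightarrow> rvec set \<Rightarrow> nat" where
  "arith_width d K = (INF c\<in>directions d. arith_width_dir d c K)"

end

theory Submission
  imports Defs
begin

text \<open>For (a), the segment from the origin to half a unit vector has a single lattice point, so every
  direction attains the minimal arithmetic width, whereas its lattice width vanishes only in the
  directions orthogonal to it.  For (b), let \<open>A = {a\<^sub>0, \<dots>, a\<^sub>n\<^sub>-\<^sub>1}\<close> and take the simplex spanned
  by \<open>e\<^sub>0, \<dots>, e\<^sub>n\<^sub>-\<^sub>1, e\<^sub>n / 2\<close>: its lattice points are exactly \<open>e\<^sub>0, \<dots>, e\<^sub>n\<^sub>-\<^sub>1\<close>, on which the direction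
  \<open>(a\<^sub>0, \<dots>, a\<^sub>n\<^sub>-\<^sub>1, 1)\<close> takes the values in \<open>A\<close>.\<close>

text \<open>Scaling is defined through \<open>Abs_poly_mapping\<close>, so it can be read off
  coordinatewise once the scaled function is known to have finite support.\<close>

lemma lookup_scaleR [simp]:
  "Poly_Mapping.lookup (r *\<^sub>R x) i = r *\<^sub>R Poly_Mapping.lookup x i"
proof -
  have "finite {i. r *\<^sub>R Poly_Mapping.lookup x i \<noteq> 0}"
    by (rule finite_subset [OF _ finite_lookup [of x]]) auto
  then show ?thesis
    by (simp add: scaleR_poly_mapping_def Abs_poly_mapping_inverse)
qed

lemma dotp_single:
  assumes "i < d"
  shows "dotp d c (Poly_Mapping.single i t) = Poly_Mapping.lookup c i * t"
  using assms by (simp add: dotp_def lookup_single when_def if_distrib [of "(*) _"] cong: if_cong)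

lemma single_in_Rd: "i < d \<Longrightarrow> Poly_Mapping.single i t \<in> Rd d"
  by (simp add: Rd_def)

lemma single_in_Qd: "i < d \<Longrightarrow> t \<in> \<rat> \<Longrightarrow> Poly_Mapping.single i t \<in> Qd d"
  by (auto simp: Qd_def single_in_Rd lookup_single when_def)

lemma single_in_Zd_iff: "i < d \<Longrightarrow> Poly_Mapping.single i t \<in> Zd d \<longleftrightarrow> t \<in> \<int>"
  by (auto simp: Zd_def single_in_Rd lookup_single when_def)

lemma lookup_outside_Rd: "x \<in> Rd d \<Longrightarrow> d \<le> i \<Longrightarrow> Poly_Mapping.lookup x i = 0"
  by (auto simp: Rd_def subset_iff in_keys_iff)

lemma convex_Rd: "convex (Rd d)"
proof -
  have "Rd d = {x. \<forall>i\<ge>d. Poly_Mapping.lookup x i = 0}"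
    by (auto simp: Rd_def subset_iff in_keys_iff not_less [symmetric])
  then show ?thesis
    by (auto simp: convex_def lookup_add)
qed

lemma rational_polytope_imp_convex_body:
  assumes "rational_polytope d K"
  shows "convex_body d K"
proof -
  obtain V where V: "finite V" "V \<noteq> {}" "V \<subseteq> Qd d" "K = convex hull V"
    using assms by (auto simp: rational_polytope_def)
  have "convex hull V \<subseteq> Rd d"
    using V(3) by (intro hull_minimal convex_Rd) (auto simp: Qd_def)
  with V show ?thesis
    by (auto simp: convex_body_def finite_imp_compact_convex_hull)
qed

text \<open>A coordinate hyperplane is affine. The one for the private coordinate of
  \<open>v\<close> contains all other points, hence their affine hull, but misses
  \<open>v\<close>.\<close>

lemma not_affine_dependent_if_private_coordinate:
  fixes V :: "rvec set"
  assumes "\<And>v. v \<in> V \<Longrightarrow>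
    \<exists>i. Poly_Mapping.lookup v i \<noteq> 0 \<and> (\<forall>w\<in>V - {v}. Poly_Mapping.lookup w i = 0)"
  shows "\<not> affine_dependent V"
proof
  assume "affine_dependent V"
  then obtain v where v: "v \<in> V" "v \<in> affine hull (V - {v})"
    by (auto simp: affine_dependent_def)
  then obtain i where i: "Poly_Mapping.lookup v i \<noteq> 0" "\<forall>w\<in>V - {v}. Poly_Mapping.lookup w i = 0"
    using assms by blast
  have "affine hull (V - {v}) \<subseteq> {x. Poly_Mapping.lookup x i = 0}"
    using i(2) by (intro hull_minimal) (auto simp: affine_def lookup_add)
  with v i(1) show False by auto
qed

lemma lattice_width_differs_from_arith_width:
  "\<exists>K. convex_body 2 K \<and> rational_polytope 2 K \<and>
     {c \<in> directions 2. lattice_width_dir 2 c K = lattice_width 2 K}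
       \<noteq> {c \<in> directions 2. arith_width_dir 2 c K = arith_width 2 K}"
proof -
  define e :: "nat \<Rightarrow> rvec" where "e i = Poly_Mapping.single i 1" for i
  define K :: "rvec set" where "K = convex hull {0, Poly_Mapping.single 0 (1/2)}"
  \<comment> \<open>Parametrising the segment by its first coordinate turns both widths into
    questions about reals in [0, 1/2].\<close>
  have K_eq: "K = (\<lambda>t. Poly_Mapping.single 0 t) ` {0..1/2}"
  proof -
    have *: "u *\<^sub>R (Poly_Mapping.single 0 (1/2) :: rvec) = Poly_Mapping.single 0 (u/2)" for u
      by (rule poly_mapping_eqI) (simp add: lookup_single when_def)
    have "K = (\<lambda>u. Poly_Mapping.single 0 (u/2)) ` {0..1}"
      unfolding K_def segment_convex_hull [symmetric] by (simp add: closed_segment_image_interval *)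
    also have "\<dots> = (\<lambda>t. Poly_Mapping.single 0 t) ` ((\<lambda>u. u/2) ` {0..1})"
      by (simp only: image_image)
    also have "(\<lambda>u::real. u/2) ` {0..1} = {0..1/2}"
      by simp
    finally show ?thesis .
  qed
  have polytope: "rational_polytope 2 K"
    unfolding rational_polytope_def K_def
    by (intro exI [of _ "{0, Poly_Mapping.single 0 (1/2)}"])
      (auto simp: Qd_def Rd_def lookup_single when_def)
  have dir: "e i \<in> directions 2" if "i < 2" for i
  proof -
    have "Poly_Mapping.lookup (e i) i \<noteq> 0"
      by (simp add: e_def)
    then have "e i \<noteq> 0" by auto
    with that show ?thesis
      unfolding directions_def e_def by (simp only: single_in_Zd_iff Diff_iff) simp
  qed
  have width: "lattice_width_dir 2 c K = \<bar>Poly_Mapping.lookup c 0\<bar> / 2" for c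
  proof -
    let ?a = "Poly_Mapping.lookup c 0"
    have "{dotp 2 c (x - y) | x y. x \<in> K \<and> y \<in> K} = {?a * (s - t) | s t. s \<in> {0..1/2} \<and> t \<in> {0..1/2}}"
      unfolding K_eq by (force simp: single_diff [symmetric] dotp_single)
    moreover have "Sup \<dots> = \<bar>?a\<bar> / 2"
    proof (rule cSup_eq_maximum)
      \<comment> \<open>The maximum is attained at the two endpoints of the segment, ordered
        according to the sign of \<open>?a\<close>.\<close>
      have "\<bar>?a\<bar> / 2 = ?a * ((if ?a \<ge> 0 then 1/2 else 0) - (if ?a \<ge> 0 then 0 else 1/2))"
        by simp
      moreover have "(if ?a \<ge> 0 then 1/2 else 0) \<in> {0..1/2::real}"
        "(if ?a \<ge> 0 then 0 else 1/2) \<in> {0..1/2::real}"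
        by auto
      ultimately show "\<bar>?a\<bar> / 2 \<in> {?a * (s - t) | s t. s \<in> {0..1/2} \<and> t \<in> {0..1/2}}"
        by blast
    next
      fix z assume "z \<in> {?a * (s - t) | s t. s \<in> {0..1/2} \<and> t \<in> {0..1/2}}"
      then obtain s t where z: "z = ?a * (s - t)" "s \<in> {0..1/2}" "t \<in> {0..1/2}"
        by blast
      have "z \<le> \<bar>?a\<bar> * \<bar>s - t\<bar>"
        unfolding z(1) by (metis abs_ge_self abs_mult)
      also have "\<dots> \<le> \<bar>?a\<bar> * (1/2)"
        using z(2,3) by (intro mult_left_mono) (auto simp: abs_if)
      finally show "z \<le> \<bar>?a\<bar> / 2" by simp
    qed
    ultimately show ?thesis by (simp add: lattice_width_dir_def)
  qed
  \<comment> \<open>Directional widths are nonnegative, and \<open>e 1\<close>, orthogonal to the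
    segment, has width 0. The direction \<open>e 0\<close> along the segment has width 1/2, so it is
    not minimal.\<close>
  have "lattice_width 2 K = 0"
    unfolding lattice_width_def
  proof (rule cInf_eq_minimum)
    show "0 \<in> (\<lambda>c. lattice_width_dir 2 c K) ` directions 2"
      using dir [of 1] by (intro image_eqI [of _ _ "e 1"]) (auto simp: width e_def lookup_single)
  qed (auto simp: width)
  then have "lattice_width_dir 2 (e 0) K \<noteq> lattice_width 2 K"
    by (simp add: width e_def)
  moreover have "arith_width_dir 2 c K = 1" for c
  proof -
    have "K \<inter> Zd 2 = {0}"
    proof (intro equalityI subsetI)
      fix x assume "x \<in> K \<inter> Zd 2"
      then obtain t where t: "x = Poly_Mapping.single 0 t" "0 \<le> t" "t \<le> 1/2" "t \<in> \<int>"
        by (auto simp: K_eq single_in_Zd_iff)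
      then have "t = 0"
        by (auto elim!: Ints_cases)
      with t(1) show "x \<in> {0}" by simp
    qed (auto simp: K_def Zd_def Rd_def intro: hull_inc)
    then have "arith_range 2 c K = {0}"
      by (auto simp: arith_range_def dotp_def)
    then show ?thesis by (simp add: arith_width_dir_def)
  qed
  \<comment> \<open>The constant value 1 passes to the infimum because the set of directions is
    nonempty. Thus \<open>e 0\<close> lies in the second set of directions but not in the
    first.\<close>
  then have "arith_width_dir 2 (e 0) K = arith_width 2 K"
    using dir [of 0] cINF_const [of "directions 2" "1::nat"] by (fastforce simp: arith_width_def)
  ultimately show ?thesis
    using polytope rational_polytope_imp_convex_body dir [of 0] by auto
qed

lemma arith_range_of_rational_simplex:
  assumes "finite A"
  shows "\<exists>k\<ge>1. \<exists>\<Delta> c. rational_simplex k \<Delta> \<and> c \<in> directions k \<and> arith_range k c \<Delta> = A"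
proof -
  obtain a :: "nat \<Rightarrow> int" and n where A: "A = a ` {..<n}"
    using finite_imp_nat_seg_image_inj_on [OF assms] by (auto simp: lessThan_def)
  \<comment> \<open>The vertex with entry 1/2 is no lattice point. It keeps the simplex nonempty and
    the dimension positive when \<open>A\<close> is empty, that is, when
    \<open>n = 0\<close>.\<close>
  define h :: "nat \<Rightarrow> real" where "h i = (if i < n then 1 else 1/2)" for i
  define v :: "nat \<Rightarrow> rvec" where "v i = Poly_Mapping.single i (h i)" for i
  define c :: rvec where
    "c = (\<Sum>i\<le>n. Poly_Mapping.single i (if i < n then of_int (a i) else 1))"
  have lookup_c: "Poly_Mapping.lookup c i = (if i < n then of_int (a i) else if i = n then 1 else 0)" for i
    by (auto simp: c_def lookup_sum lookup_single when_def)
  have lookup_v: "Poly_Mapping.lookup (v i) j = (if i = j then h i else 0)" for i j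
    by (simp add: v_def lookup_single when_def)
  have h_pos: "h i > 0" for i
    by (simp add: h_def)
  define \<Delta> where "\<Delta> = convex hull (v ` {..n})"
  have "\<not> affine_dependent (v ` {..n})"
  proof (rule not_affine_dependent_if_private_coordinate)
    fix w assume "w \<in> v ` {..n}"
    then obtain i where "w = v i" by auto
    then show "\<exists>j. Poly_Mapping.lookup w j \<noteq> 0 \<and> (\<forall>u\<in>v ` {..n} - {w}. Poly_Mapping.lookup u j = 0)"
      using h_pos [of i] by (intro exI [of _ i]) (auto simp: lookup_v split: if_splits)
  qed
  moreover have "v ` {..n} \<subseteq> Qd (Suc n)"
    by (auto simp: v_def h_def intro!: single_in_Qd)
  ultimately have simplex: "rational_simplex (Suc n) \<Delta>"
    unfolding rational_simplex_def \<Delta>_def by (intro exI [of _ "v ` {..n}"]) auto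
  \<comment> \<open>The last entry 1 makes \<open>c\<close> nonzero even if all \<open>a i\<close>
    are 0. It does not affect the range, since coordinate \<open>n\<close> vanishes on every lattice
    point of the simplex.\<close>
  have "Poly_Mapping.lookup c n \<noteq> 0"
    by (simp add: lookup_c)
  then have "c \<noteq> 0" by auto
  moreover have "c \<in> Zd (Suc n)"
    by (auto simp: Zd_def Rd_def in_keys_iff lookup_c split: if_splits)
  ultimately have dir: "c \<in> directions (Suc n)"
    by (simp add: directions_def)
  have v_in: "v i \<in> \<Delta> \<inter> Zd (Suc n)" if "i < n" for i
    using that by (auto simp: \<Delta>_def v_def h_def single_in_Zd_iff intro!: hull_inc)
  have lattice_point: "\<exists>i<n. x = v i" if "x \<in> \<Delta>" "x \<in> Zd (Suc n)" for x
  proof -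
    let ?x = "Poly_Mapping.lookup x"
    \<comment> \<open>The equation holds at all vertices: the coefficient 2 compensates for the
      entry 1/2 of \<open>v n\<close>.\<close>
    let ?S = "{x :: rvec. (\<forall>i. 0 \<le> Poly_Mapping.lookup x i) \<and>
                  (\<Sum>i<n. Poly_Mapping.lookup x i) + 2 * Poly_Mapping.lookup x n = 1}"
    have "convex ?S"
    proof (rule convexI)
      fix x y s t
      assume x: "x \<in> ?S" and y: "y \<in> ?S" and st: "0 \<le> s" "0 \<le> t" "s + t = (1::real)"
      have "(\<Sum>i<n. Poly_Mapping.lookup (s *\<^sub>R x + t *\<^sub>R y) i) +
          2 * Poly_Mapping.lookup (s *\<^sub>R x + t *\<^sub>R y) n =
          s * ((\<Sum>i<n. Poly_Mapping.lookup x i) + 2 * Poly_Mapping.lookup x n) +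
          t * ((\<Sum>i<n. Poly_Mapping.lookup y i) + 2 * Poly_Mapping.lookup y n)"
        by (simp add: lookup_add sum.distrib sum_distrib_left algebra_simps)
      with x y st show "s *\<^sub>R x + t *\<^sub>R y \<in> ?S"
        by (simp add: lookup_add)
    qed
    then have "\<Delta> \<subseteq> ?S"
      unfolding \<Delta>_def by (intro hull_minimal) (auto simp: lookup_v h_def)
    with that have nonneg: "\<And>i. 0 \<le> ?x i" and sum: "(\<Sum>i<n. ?x i) + 2 * ?x n = 1"
      by auto
    have int: "?x i \<in> \<int>" if "i \<le> n" for i
      using \<open>x \<in> Zd (Suc n)\<close> that by (simp add: Zd_def)
    \<comment> \<open>Coordinate \<open>n\<close> is an integer in [0, 1/2], hence 0. The first
      \<open>n\<close> coordinates are then nonnegative integers with sum 1, so exactly one is 1 and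
      the others are 0. For \<open>n = 0\<close> the empty sum already gives a
      contradiction.\<close>
    have "2 * ?x n \<le> 1"
      using sum nonneg by (smt (verit) sum_nonneg)
    then have xn: "?x n = 0"
      using int [of n] nonneg [of n] by (auto elim!: Ints_cases)
    with sum obtain i where i: "i < n" "?x i \<noteq> 0"
      by (metis add.right_neutral lessThan_iff mult_zero_right sum.neutral zero_neq_one)
    have "?x i \<ge> 1"
      using int [of i] i nonneg [of i] by (auto elim!: Ints_cases)
    moreover have "(\<Sum>j<n. ?x j) = ?x i + (\<Sum>j\<in>{..<n} - {i}. ?x j)"
      using i by (intro sum.remove) auto
    moreover have "(\<Sum>j\<in>{..<n} - {i}. ?x j) \<ge> 0"
      using nonneg by (simp add: sum_nonneg)
    ultimately have xi: "?x i = 1" and "(\<Sum>j\<in>{..<n} - {i}. ?x j) = 0"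
      using sum xn by auto
    then have rest: "?x j = 0" if "j < n" "j \<noteq> i" for j
      using nonneg that by (auto simp: sum_nonneg_eq_0_iff)
    \<comment> \<open>The equation in \<open>?S\<close> says nothing about coordinates beyond
      \<open>n\<close>; these vanish because \<open>x\<close> lies in
      \<open>Rd (Suc n)\<close>.\<close>
    have "?x j = 0" if "j > n" for j
      using \<open>x \<in> Zd (Suc n)\<close> that by (auto simp: Zd_def intro: lookup_outside_Rd)
    with xi xn rest i have "x = v i"
      by (intro poly_mapping_eqI) (metis h_def lookup_v linorder_neqE_nat)
    with i show ?thesis by blast
  qed
  have dotp_v: "dotp (Suc n) c (v i) = of_int (a i)" if "i < n" for i
    using that by (simp add: v_def dotp_single lookup_c h_def)
  have "\<Delta> \<inter> Zd (Suc n) = v ` {..<n}"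
    using v_in lattice_point by blast
  then have "arith_range (Suc n) c \<Delta> = A"
    by (auto simp: arith_range_def A dotp_v)
  with simplex dir show ?thesis
    by (intro exI [of _ "Suc n"]) auto
qed

theorem theoremD:
  shows "(\<exists>K. convex_body 2 K \<and> rational_polytope 2 K \<and>
            {c \<in> directions 2. lattice_width_dir 2 c K = lattice_width 2 K}
              \<noteq> {c \<in> directions 2. arith_width_dir 2 c K = arith_width 2 K})
       \<and> (\<forall>A :: int set. finite A \<longrightarrow>
            (\<exists>k\<ge>1. \<exists>\<Delta> c. rational_simplex k \<Delta> \<and> c \<in> directions k \<and> arith_range k c \<Delta> = A))"
  using lattice_width_differs_from_arith_width arith_range_of_rational_simplex by blast

end
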